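(* Let $\alpha\in(0,3]$. If $f=h+\overline{g}\in\mathcal{F}_{\mathcal{H}}(\alpha)$ with $g'=\omega h'$, then $\|P_f\|\leq2\alpha+1$. The estimate $2\alpha+1$ is best possible (it cannot be replaced by a smaller constant valid for all $f\in\mathcal{F}_{\mathcal{H}}(\alpha)$).
   Context: $\mathbb{D}=\{z\in\mathbb{C}:|z|<1\}$. $\mathcal{A}$ is the family of analytic functions $h$ in $\mathbb{D}$ with $h(0)=0$ and $h'(0)=1$. For $\alpha\in(0,3]$, $\mathcal{F}(\alpha)$ is the family of locally univalent functions $h\in\mathcal{A}$ (i.e. $h'(z)\neq0$ in $\mathbb{D}$) such that $\operatorname{Re}\left(1+\frac{zh''(z)}{h'(z)}\right)>1-\frac{\alpha}{2}$ for all $z\in\mathbb{D}$. $\mathcal{H}$ is the class of complex-valued harmonic mappings $f=h+\overline{g}$ in $\mathbb{D}$ with $h,g$ analytic in $\mathbb{D}$, $h(0)=h'(0)-1=0$ and $g(0)=0$. $\mathcal{F}_{\mathcal{H}}(\alpha)$ is the class of sense-preserving $f=h+\overline{g}\in\mathcal{H}$ with $h\in\mathcal{F}(\alpha)$ and $g'=\omega h'$, where the dilatation $\omega=g'/h'$ is analytic with $|\omega(z)|<1$ in $\mathbb{D}$. The pre-Schwarzian derivative of such $f$ is $P_f=(\log J_f)_z=\frac{h''}{h'}-\frac{\overline{\omega}\,\omega'}{1-|\omega|^2}$, where $J_f=|h'|^2-|g'|^2$, and its norm is $\|P_f\|=\sup_{z\in\mathbb{D}}(1-|z|^2)|P_f(z)|$.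 *)

theory Defs
  imports "HOL-Complex_Analysis.Complex_Analysis"
begin

abbreviation unit_disc :: "complex set" where
  "unit_disc \<equiv> ball 0 1"

text \<open>The Wirtinger derivatives \<open>f\<^sub>z = (f\<^sub>x - \<i> f\<^sub>y) / 2\<close> and \<open>(f\<^sub>x + \<i> f\<^sub>y) / 2\<close> (the derivative with
  respect to the conjugate variable), read off from the real Frechet derivative.\<close>

definition wirtinger :: "(complex \<Rightarrow> complex) \<Rightarrow> complex \<Rightarrow> complex" where
  "wirtinger f z =
     (frechet_derivative f (at z) 1 - \<i> * frechet_derivative f (at z) \<i>) / 2"

definition wirtinger_cnj :: "(complex \<Rightarrow> complex) \<Rightarrow> complex \<Rightarrow> complex" where
  "wirtinger_cnj f z =
     (frechet_derivative f (at z) 1 + \<i> * frechet_derivative f (at z) \<i>) / 2"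

text \<open>The Jacobian determinant of \<open>f\<close> as a planar map; for \<open>f = h + cnj g\<close> with \<open>h\<close>, \<open>g\<close> analytic
  it is \<open>\<bar>h'\<bar>\<^sup>2 - \<bar>g'\<bar>\<^sup>2\<close>, see \<open>jacobian_harmonic\<close> below.\<close>

definition jacobian :: "(complex \<Rightarrow> complex) \<Rightarrow> complex \<Rightarrow> real" where
  "jacobian f z = (cmod (wirtinger f z))\<^sup>2 - (cmod (wirtinger_cnj f z))\<^sup>2"

definition sense_preserving :: "(complex \<Rightarrow> complex) \<Rightarrow> bool" where
  "sense_preserving f \<longleftrightarrow> (\<forall>z\<in>unit_disc. jacobian f z > 0)"

definition pre_schwarzian :: "(complex \<Rightarrow> complex) \<Rightarrow> complex \<Rightarrow> complex" where
  "pre_schwarzian f = wirtinger (\<lambda>z. complex_of_real (ln (jacobian f z)))"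

text \<open>The supremum is taken in the extended reals, so that a bound on the norm includes its
  finiteness.\<close>

definition pre_schwarzian_norm :: "(complex \<Rightarrow> complex) \<Rightarrow> ereal" where
  "pre_schwarzian_norm f =
     (SUP z\<in>unit_disc. ereal ((1 - (cmod z)\<^sup>2) * cmod (pre_schwarzian f z)))"

definition class_A :: "(complex \<Rightarrow> complex) set" where
  "class_A = {h. h holomorphic_on unit_disc \<and> h 0 = 0 \<and> deriv h 0 = 1}"

definition class_F :: "real \<Rightarrow> (complex \<Rightarrow> complex) set" where
  "class_F \<alpha> = {h \<in> class_A. \<forall>z\<in>unit_disc. deriv h z \<noteq> 0 \<and>
     Re (1 + z * deriv (deriv h) z / deriv h z) > 1 - \<alpha> / 2}"

text \<open>\<open>f = h + cnj g\<close> is a normalised harmonic mapping of the disc. The values of these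
  total functions outside the disc are irrelevant.\<close>

definition harmonic_rep ::
    "(complex \<Rightarrow> complex) \<Rightarrow> (complex \<Rightarrow> complex) \<Rightarrow> (complex \<Rightarrow> complex) \<Rightarrow> bool" where
  "harmonic_rep f h g \<longleftrightarrow>
     h \<in> class_A \<and> g holomorphic_on unit_disc \<and> g 0 = 0 \<and>
     (\<forall>z\<in>unit_disc. f z = h z + cnj (g z))"

definition dilatation ::
    "(complex \<Rightarrow> complex) \<Rightarrow> (complex \<Rightarrow> complex) \<Rightarrow> (complex \<Rightarrow> complex) \<Rightarrow> bool" where
  "dilatation \<omega> h g \<longleftrightarrow>
     \<omega> holomorphic_on unit_disc \<and>
     (\<forall>z\<in>unit_disc. cmod (\<omega> z) < 1 \<and> deriv g z = \<omega> z * deriv h z)"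

definition class_FH :: "real \<Rightarrow> (complex \<Rightarrow> complex) set" where
  "class_FH \<alpha> = {f. sense_preserving f \<and>
     (\<exists>h g \<omega>. harmonic_rep f h g \<and> h \<in> class_F \<alpha> \<and> dilatation \<omega> h g)}"

lemma wirtinger_eqI:
  assumes "(f has_derivative D) (at z)"
  shows "wirtinger f z = (D 1 - \<i> * D \<i>) / 2"
    and "wirtinger_cnj f z = (D 1 + \<i> * D \<i>) / 2"
  using frechet_derivative_at[OF assms] by (simp_all add: wirtinger_def wirtinger_cnj_def)

lemma wirtinger_harmonic:
  assumes rep: "harmonic_rep f h g" and z: "z \<in> unit_disc"
  shows "wirtinger f z = deriv h z" and "wirtinger_cnj f z = cnj (deriv g z)"
proof -
  have "(h has_field_derivative deriv h z) (at z)" "(g has_field_derivative deriv g z) (at z)"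
    using rep z by (auto simp: harmonic_rep_def class_A_def intro: holomorphic_derivI)
  then have "((\<lambda>w. h w + cnj (g w)) has_derivative
      (\<lambda>v. deriv h z * v + cnj (deriv g z * v))) (at z)"
    unfolding has_field_derivative_def
    by (intro has_derivative_add has_derivative_cnj)
  then have D: "(f has_derivative (\<lambda>v. deriv h z * v + cnj (deriv g z * v))) (at z)"
    by (rule has_derivative_transform_within_open[where s = unit_disc])
       (use rep z in \<open>auto simp: harmonic_rep_def\<close>)
  show "wirtinger f z = deriv h z" "wirtinger_cnj f z = cnj (deriv g z)"
    by (simp_all add: wirtinger_eqI[OF D] algebra_simps flip: mult.assoc)
qed

lemma jacobian_harmonic:
  assumes "harmonic_rep f h g" and "z \<in> unit_disc"
  shows "jacobian f z = (cmod (deriv h z))\<^sup>2 - (cmod (deriv g z))\<^sup>2"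
  by (simp add: jacobian_def wirtinger_harmonic[OF assms])

lemma has_derivative_cmod_power2:
  assumes "(p has_field_derivative p') (at z)"
  shows "((\<lambda>w. (cmod (p w))\<^sup>2) has_derivative (\<lambda>v. 2 * Re (cnj (p z) * p' * v))) (at z)"
proof -
  have D: "(p has_derivative (\<lambda>v. p' * v)) (at z)"
    using assms by (simp add: has_field_derivative_def)
  show ?thesis
    unfolding cmod_power2 
    by (rule derivative_eq_intros has_derivative_Re[OF D] has_derivative_Im[OF D] refl)+
       (auto simp: fun_eq_iff algebra_simps)
qed

lemma pre_schwarzian_harmonic:
  assumes rep: "harmonic_rep f h g" and dil: "dilatation \<omega> h g"
    and h': "\<And>z. z \<in> unit_disc \<Longrightarrow> deriv h z \<noteq> 0" and z: "z \<in> unit_disc"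
  shows "pre_schwarzian f z =
    deriv (deriv h) z / deriv h z - cnj (\<omega> z) * deriv \<omega> z / (1 - (cmod (\<omega> z))\<^sup>2)"
proof -
  have hol: "h holomorphic_on unit_disc" "g holomorphic_on unit_disc" "\<omega> holomorphic_on unit_disc"
    using rep dil by (auto simp: harmonic_rep_def class_A_def dilatation_def)
  have dh: "(deriv h has_field_derivative deriv (deriv h) z) (at z)"
    and d\<omega>: "(\<omega> has_field_derivative deriv \<omega> z) (at z)"
    using hol z by (auto intro!: holomorphic_derivI holomorphic_deriv)
  define g'' where "g'' = deriv \<omega> z * deriv h z + deriv (deriv h) z * \<omega> z"
  have "((\<lambda>w. \<omega> w * deriv h w) has_field_derivative g'') (at z)"
    unfolding g''_def by (rule DERIV_mult[OF d\<omega> dh])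
  then have dg: "(deriv g has_field_derivative g'') (at z)"
    by (rule has_field_derivative_transform_within_open[where S = unit_disc])
       (use dil z in \<open>auto simp: dilatation_def\<close>)
  define J where "J = (\<lambda>w. (cmod (deriv h w))\<^sup>2 - (cmod (deriv g w))\<^sup>2)"
  have g'z: "deriv g z = \<omega> z * deriv h z" and \<omega>z: "cmod (\<omega> z) < 1"
    using dil z by (auto simp: dilatation_def)
  have \<omega>1: "1 - (cmod (\<omega> z))\<^sup>2 > 0"
    using \<omega>z by (simp add: power_less_one_iff abs_square_less_1)
  have Jz: "J z = (cmod (deriv h z))\<^sup>2 * (1 - (cmod (\<omega> z))\<^sup>2)"
    by (simp add: J_def g'z norm_mult power_mult_distrib algebra_simps)
  have Jpos: "J z > 0" unfolding Jz using \<omega>1 h'[OF z] by simp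
  define a where "a = cnj (deriv h z) * deriv (deriv h) z - cnj (deriv g z) * g''"
  have "(J has_derivative (\<lambda>v. 2 * Re (a * v))) (at z)"
    unfolding J_def a_def
    by (rule has_derivative_eq_rhs[OF has_derivative_diff[OF
          has_derivative_cmod_power2[OF dh] has_derivative_cmod_power2[OF dg]]])
       (auto simp: fun_eq_iff algebra_simps)
  then have "((\<lambda>w. ln (J w)) has_derivative (\<lambda>v. 2 * Re (a * v) * inverse (J z))) (at z)"
    using Jpos by (auto intro!: derivative_eq_intros simp: divide_simps)
  then have "((\<lambda>w. complex_of_real (ln (J w))) has_derivative
      (\<lambda>v. complex_of_real (2 * Re (a * v) * inverse (J z)))) (at z)"
    by (rule has_derivative_of_real)
  then have D: "((\<lambda>w. complex_of_real (ln (jacobian f w))) has_derivative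
      (\<lambda>v. complex_of_real (2 * Re (a * v) * inverse (J z)))) (at z)"
    by (rule has_derivative_transform_within_open[where s = unit_disc])
       (use z jacobian_harmonic[OF rep] in \<open>auto simp: J_def\<close>)
  have "pre_schwarzian f z = a / J z"
    unfolding pre_schwarzian_def wirtinger_eqI(1)[OF D]
    by (simp add: complex_eq_iff divide_simps)
  also have "\<dots> = deriv (deriv h) z / deriv h z
      - cnj (\<omega> z) * deriv \<omega> z / (1 - (cmod (\<omega> z))\<^sup>2)"
  proof -
    define H K w w' where "H = deriv h z" and "K = deriv (deriv h) z"
      and "w = \<omega> z" and "w' = deriv \<omega> z"
    have H: "H \<noteq> 0" using h'[OF z] by (simp add: H_def)
    have nz: "1 - w * cnj w \<noteq> 0"
      using \<omega>1 unfolding w_def complex_norm_square[symmetric]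
      by (metis of_real_1 of_real_diff of_real_eq_0_iff less_irrefl)
    have "complex_of_real (J z) = H * cnj H * (1 - w * cnj w)"
      unfolding Jz H_def w_def by (simp add: complex_norm_square[symmetric])
    moreover have "a = cnj H * (K * (1 - w * cnj w) - cnj w * w' * H)"
      by (simp add: a_def g'z g''_def H_def K_def w_def w'_def algebra_simps)
    ultimately have "a / J z = (K * (1 - w * cnj w) - cnj w * w' * H) / (H * (1 - w * cnj w))"
      using H by (simp add: mult.assoc mult.left_commute[of H])
    also have "\<dots> = K / H - cnj w * w' / (1 - w * cnj w)"
      using H nz by (simp add: diff_divide_distrib)
    also have "1 - w * cnj w = complex_of_real (1 - (cmod w)\<^sup>2)"
      by (simp add: complex_norm_square[symmetric])
    finally have "a / J z = K / H - cnj w * w' / complex_of_real (1 - (cmod w)\<^sup>2)" .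
    then show ?thesis by (simp add: H_def K_def w_def w'_def)
  qed
  finally show ?thesis .
qed

end

theory Submission
  imports Defs
begin

text \<open>Write \<open>P\<^sub>f = h''/h' - cnj \<omega> \<omega>' / (1 - \<bar>\<omega>\<bar>\<^sup>2)\<close> and bound the two terms separately.
  The defining condition of \<open>class_F\<close> says that \<open>z h''/h'\<close> stays in a half-plane; mapping
  this half-plane to the disc and applying the Schwarz lemma gives \<open>\<bar>h''/h'\<bar> \<le> \<alpha> / (1 - \<bar>z\<bar>)\<close>, so
  the first term contributes at most \<open>\<alpha> (1 + \<bar>z\<bar>) \<le> 2 \<alpha>\<close> after multiplication by \<open>1 - \<bar>z\<bar>\<^sup>2\<close>.
  By the Schwarz--Pick inequality the second term contributes at most \<open>\<bar>\<omega>\<bar> \<le> 1\<close>.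

  The two bounds can be nearly attained at the same point. With \<open>h' = (1 - z)\<^sup>-\<^sup>\<alpha>\<close> the first one is an
  equality on \<open>[0,1)\<close>, with \<open>h''/h'\<close> positive there. The Schwarz--Pick inequality is an
  equality for every disc automorphism. For \<open>\<omega> z = (a - z) / (1 - a z)\<close> the derivative is
  negative on the real axis, so the second term has the same sign as the first wherever \<open>\<omega>\<close> is
  positive. Given \<open>x\<close> and \<open>t\<close> in \<open>(0,1)\<close>, a suitable real \<open>a\<close> makes \<open>\<omega> x = t\<close>, and the weighted
  pre-Schwarzian at \<open>x\<close> becomes \<open>\<alpha> (1 + x) + t\<close>, which tends to \<open>2 \<alpha> + 1\<close> as
  \<open>x\<close> and \<open>t\<close> tend to \<open>1\<close>.\<close>

section \<open>The Schwarz--Pick inequality\<close>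

lemma one_minus_cnj_mult_ne_zero:
  fixes w z :: complex
  assumes "cmod w < 1" "cmod z < 1"
  shows "1 - cnj w * z \<noteq> 0"
proof -
  have "cmod (cnj w * z) < 1"
    using norm_mult_less[of "cnj w" 1 z 1] assms by simp
  then show ?thesis
    by auto
qed

lemma Moebius_function_has_field_derivative:
  assumes "1 - cnj w * z \<noteq> 0"
  shows "(Moebius_function 0 w has_field_derivative
    (1 - of_real ((cmod w)\<^sup>2)) / (1 - cnj w * z)\<^sup>2) (at z)"
  unfolding Moebius_function_def complex_norm_square
  by (rule derivative_eq_intros refl | use assms in \<open>simp add: power2_eq_square algebra_simps\<close>)+

text \<open>Composing with disc automorphisms that move \<open>z\<close> and \<open>\<omega> z\<close> to the origin reduces this to the
  derivative bound of the Schwarz lemma.\<close>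

lemma Schwarz_Pick_derivative:
  assumes hol: "\<omega> holomorphic_on ball 0 1"
    and less1: "\<And>z. z \<in> ball 0 1 \<Longrightarrow> cmod (\<omega> z) < 1"
    and z: "z \<in> ball 0 1"
  shows "(1 - (cmod z)\<^sup>2) * cmod (deriv \<omega> z) \<le> 1 - (cmod (\<omega> z))\<^sup>2"
proof -
  define w where "w = \<omega> z"
  have w: "cmod w < 1" and z1: "cmod z < 1"
    using less1[OF z] z by (auto simp: w_def)
  define F where "F = Moebius_function 0 w \<circ> (\<omega> \<circ> Moebius_function 0 (-z))"
  have inner: "Moebius_function 0 (-z) ` ball 0 1 \<subseteq> ball 0 1"
    using Moebius_function_norm_lt_1[of "-z"] z1 by auto
  have "F holomorphic_on ball 0 1"
    unfolding F_def
  proof (rule holomorphic_on_compose_gen[where t = "ball 0 1"])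
    show "\<omega> \<circ> Moebius_function 0 (-z) holomorphic_on ball 0 1"
      by (rule holomorphic_on_compose_gen[OF _ hol inner])
         (use z1 in \<open>auto intro: Moebius_function_holomorphic\<close>)
    show "(\<omega> \<circ> Moebius_function 0 (-z)) ` ball 0 1 \<subseteq> ball 0 1"
      using inner less1 by fastforce
  qed (use w in \<open>auto intro: Moebius_function_holomorphic\<close>)
  moreover have "F 0 = 0"
    by (simp add: F_def w_def Moebius_function_simple)
  moreover have "cmod (F u) < 1" if "cmod u < 1" for u
    unfolding F_def o_def
    by (rule Moebius_function_norm_lt_1[OF w], rule less1)
       (use that z1 Moebius_function_norm_lt_1[of "-z" u 0] in auto)
  ultimately have "cmod (deriv F 0) \<le> 1"
    using Schwarz_Lemma(2)[of F 0] by simp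
  moreover have "deriv F 0 = deriv \<omega> z * (1 - of_real ((cmod z)\<^sup>2)) / (1 - of_real ((cmod w)\<^sup>2))"
  proof -
    have nz: "1 - cnj w * w \<noteq> 0"
      by (rule one_minus_cnj_mult_ne_zero[OF w w])
    have inner0: "Moebius_function 0 (-z) 0 = z"
      by (simp add: Moebius_function_simple)
    have "(Moebius_function 0 (-z) has_field_derivative 1 - of_real ((cmod z)\<^sup>2)) (at 0)"
      using Moebius_function_has_field_derivative[of "-z" 0] by simp
    moreover have "(\<omega> has_field_derivative deriv \<omega> z) (at z)"
      using holomorphic_derivI[OF hol _ z] by simp
    ultimately have "(\<omega> \<circ> Moebius_function 0 (-z) has_field_derivative
        deriv \<omega> z * (1 - of_real ((cmod z)\<^sup>2))) (at 0)"
      by (intro DERIV_chain) (simp_all only: inner0)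
    moreover have "(Moebius_function 0 w has_field_derivative
        (1 - of_real ((cmod w)\<^sup>2)) / (1 - cnj w * w)\<^sup>2) (at ((\<omega> \<circ> Moebius_function 0 (-z)) 0))"
      using Moebius_function_has_field_derivative[OF nz] by (simp add: inner0 w_def)
    ultimately have "(F has_field_derivative (1 - of_real ((cmod w)\<^sup>2)) / (1 - cnj w * w)\<^sup>2 *
        (deriv \<omega> z * (1 - of_real ((cmod z)\<^sup>2)))) (at 0)"
      unfolding F_def by (rule DERIV_chain[rotated])
    moreover have "1 - cnj w * w = 1 - of_real ((cmod w)\<^sup>2)"
      by (subst complex_norm_square) (simp add: mult.commute)
    ultimately show ?thesis
      using nz by (simp add: DERIV_imp_deriv power2_eq_square)
  qed
  moreover have "(cmod z)\<^sup>2 < 1" and w2: "(cmod w)\<^sup>2 < 1"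
    using z1 w by (simp_all add: power_less_one_iff abs_square_less_1)
  moreover have "cmod (1 - of_real r) = 1 - r" if "r < 1" for r :: real
    using that by (metis abs_of_pos diff_gt_0_iff_gt norm_of_real of_real_1 of_real_diff)
  ultimately have "cmod (deriv \<omega> z) * (1 - (cmod z)\<^sup>2) / (1 - (cmod w)\<^sup>2) \<le> 1"
    by (simp only: norm_mult norm_divide)
  then show ?thesis
    using w2 by (simp add: w_def mult.commute)
qed

section \<open>The upper bound\<close>

text \<open>The map \<open>p \<mapsto> p / (\<alpha> + p)\<close> takes the half-plane \<open>Re p > - \<alpha>/2\<close> to the disc and fixes the
  origin. The Schwarz lemma applied to its composition with \<open>z q(z)\<close> gives
  \<open>\<bar>q\<bar> \<le> \<bar>\<alpha> + z q\<bar> \<le> \<alpha> + \<bar>z\<bar> \<bar>q\<bar>\<close>.\<close>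

lemma half_plane_growth_bound:
  fixes \<alpha> :: real
  assumes \<alpha>: "\<alpha> > 0" and hol: "q holomorphic_on ball 0 1"
    and half: "\<And>z. z \<in> ball 0 1 \<Longrightarrow> Re (z * q z) > - \<alpha> / 2"
    and z: "z \<in> ball 0 1"
  shows "(1 - cmod z) * cmod (q z) \<le> \<alpha>"
proof -
  define \<psi> where "\<psi> = (\<lambda>z. q z / (\<alpha> + z * q z))"
  define \<phi> where "\<phi> = (\<lambda>z. z * \<psi> z)"
  have less: "cmod (u * q u) < cmod (\<alpha> + u * q u)" if u: "u \<in> ball 0 1" for u
  proof -
    have "0 < \<alpha> * (\<alpha> + 2 * Re (u * q u))"
      using half[OF u] \<alpha> by (intro mult_pos_pos) auto
    then have "(cmod (u * q u))\<^sup>2 < (cmod (\<alpha> + u * q u))\<^sup>2"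
      unfolding cmod_power2 by (simp add: power2_eq_square algebra_simps)
    then show ?thesis
      using power2_less_imp_less norm_ge_zero by blast
  qed
  have nz: "\<alpha> + u * q u \<noteq> 0" if "u \<in> ball 0 1" for u
    using less[OF that] by (metis norm_zero norm_not_less_zero)
  have hol\<psi>: "\<psi> holomorphic_on ball 0 1"
    unfolding \<psi>_def using nz by (intro holomorphic_intros hol) auto
  then have hol\<phi>: "\<phi> holomorphic_on ball 0 1"
    unfolding \<phi>_def by (intro holomorphic_intros)
  have bound: "cmod (\<phi> u) < 1" if "cmod u < 1" for u
    using less[of u] nz[of u] that by (simp add: \<phi>_def \<psi>_def norm_divide norm_mult)
  have schwarz: "cmod (\<phi> z) \<le> cmod z" "cmod (deriv \<phi> 0) \<le> 1"
    using Schwarz_Lemma(1,2)[OF hol\<phi> _ bound, of z] z by (simp_all add: \<phi>_def)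
  \<comment> \<open>At the origin \<open>\<bar>z \<psi> z\<bar> \<le> \<bar>z\<bar>\<close> is vacuous; there \<open>\<psi> 0\<close> is recovered as \<open>\<phi>' 0\<close>.\<close>
  have "(\<phi> has_field_derivative 1 * \<psi> 0 + deriv \<psi> 0 * 0) (at 0)"
    unfolding \<phi>_def
    by (rule DERIV_mult[OF DERIV_ident holomorphic_derivI[OF hol\<psi>]]) auto
  then have "deriv \<phi> 0 = \<psi> 0"
    by (simp add: DERIV_imp_deriv)
  with schwarz have "cmod (\<psi> z) \<le> 1"
    by (cases "z = 0") (auto simp: \<phi>_def norm_mult)
  then have "cmod (q z) \<le> cmod (\<alpha> + z * q z)"
    using nz[OF z] by (simp add: \<psi>_def norm_divide)
  also have "\<dots> \<le> \<alpha> + cmod z * cmod (q z)"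
    using norm_triangle_ineq[of "of_real \<alpha>" "z * q z"] \<alpha> by (simp add: norm_mult)
  finally show ?thesis
    by (simp add: algebra_simps)
qed

lemma class_F_pre_schwarzian_bound:
  assumes "\<alpha> > 0" and h: "h \<in> class_F \<alpha>" and z: "z \<in> ball 0 1"
  shows "(1 - (cmod z)\<^sup>2) * cmod (deriv (deriv h) z / deriv h z) \<le> \<alpha> * (1 + cmod z)"
proof -
  have "(1 - cmod z) * cmod (deriv (deriv h) z / deriv h z) \<le> \<alpha>"
  proof (rule half_plane_growth_bound[OF \<open>\<alpha> > 0\<close> _ _ z])
    show "(\<lambda>z. deriv (deriv h) z / deriv h z) holomorphic_on ball 0 1"
      using h by (auto simp: class_F_def class_A_def intro!: holomorphic_intros)
    show "Re (u * (deriv (deriv h) u / deriv h u)) > - \<alpha> / 2" if "u \<in> ball 0 1" for u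
      using h that by (fastforce simp: class_F_def)
  qed
  then have "(1 - cmod z) * cmod (deriv (deriv h) z / deriv h z) * (1 + cmod z)
      \<le> \<alpha> * (1 + cmod z)"
    by (rule mult_right_mono) simp
  then show ?thesis
    by (simp add: power2_eq_square algebra_simps)
qed

lemma pre_schwarzian_norm_le:
  assumes \<alpha>: "\<alpha> > 0" and f: "f \<in> class_FH \<alpha>"
  shows "pre_schwarzian_norm f \<le> ereal (2 * \<alpha> + 1)"
  unfolding pre_schwarzian_norm_def
proof (rule SUP_least, simp only: ereal_less_eq)
  fix z :: complex
  assume z: "z \<in> ball 0 1"
  obtain h g \<omega> where rep: "harmonic_rep f h g" and h: "h \<in> class_F \<alpha>" and dil: "dilatation \<omega> h g"
    using f by (auto simp: class_FH_def)
  have hol\<omega>: "\<omega> holomorphic_on ball 0 1" and \<omega>: "\<And>z. z \<in> ball 0 1 \<Longrightarrow> cmod (\<omega> z) < 1"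
    using dil by (auto simp: dilatation_def)
  have z1: "cmod z < 1"
    using z by simp
  have z2: "(cmod z)\<^sup>2 < 1" and \<omega>2: "(cmod (\<omega> z))\<^sup>2 < 1"
    using z1 \<omega>[OF z] by (simp_all add: power_less_one_iff abs_square_less_1)
  define A where "A = deriv (deriv h) z / deriv h z"
  define B where "B = cnj (\<omega> z) * deriv \<omega> z / (1 - (cmod (\<omega> z))\<^sup>2)"
  have "pre_schwarzian f z = A - B"
    unfolding A_def B_def
    using pre_schwarzian_harmonic[OF rep dil _ z] h by (auto simp: class_F_def)
  then have "(1 - (cmod z)\<^sup>2) * cmod (pre_schwarzian f z)
      \<le> (1 - (cmod z)\<^sup>2) * cmod A + (1 - (cmod z)\<^sup>2) * cmod B"
    using mult_left_mono[OF norm_triangle_ineq4[of A B], of "1 - (cmod z)\<^sup>2"] z2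
    by (simp add: distrib_left)
  also have "(1 - (cmod z)\<^sup>2) * cmod A \<le> 2 * \<alpha>"
  proof -
    have "\<alpha> * (1 + cmod z) \<le> \<alpha> * 2"
      using \<alpha> z1 by (intro mult_left_mono) auto
    then show ?thesis
      using class_F_pre_schwarzian_bound[OF \<alpha> h z] by (simp add: A_def)
  qed
  also have "(1 - (cmod z)\<^sup>2) * cmod B \<le> 1"
  proof -
    have "cmod (1 - of_real ((cmod (\<omega> z))\<^sup>2)) = 1 - (cmod (\<omega> z))\<^sup>2"
      using \<omega>2 by (metis abs_of_pos diff_gt_0_iff_gt norm_of_real of_real_1 of_real_diff)
    then have "(1 - (cmod z)\<^sup>2) * cmod B
        = cmod (\<omega> z) * ((1 - (cmod z)\<^sup>2) * cmod (deriv \<omega> z) / (1 - (cmod (\<omega> z))\<^sup>2))"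
      by (simp add: B_def norm_divide norm_mult)
    also have "\<dots> \<le> 1 * 1"
      using Schwarz_Pick_derivative[OF hol\<omega> \<omega> z] \<omega>[OF z] \<omega>2 z2
      by (intro mult_mono) (auto simp: divide_simps)
    finally show ?thesis
      by simp
  qed
  finally show "(1 - (cmod z)\<^sup>2) * cmod (pre_schwarzian f z) \<le> 2 * \<alpha> + 1"
    by simp
qed

section \<open>Extremal mappings\<close>

lemma normalised_primitive_on_disc:
  assumes "k holomorphic_on ball 0 1"
  obtains H where "H holomorphic_on ball 0 1" "H 0 = 0" "\<And>z. z \<in> ball 0 1 \<Longrightarrow> deriv H z = k z"
proof -
  obtain G where G: "\<And>z. z \<in> ball 0 1 \<Longrightarrow> (G has_field_derivative k z) (at z within ball 0 1)"
    using holomorphic_convex_primitive'[OF convex_ball open_ball assms] by blast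
  then have D: "((\<lambda>z. G z - G 0) has_field_derivative k z) (at z)" if "z \<in> ball 0 1" for z
    using DERIV_diff[OF G[OF that] DERIV_const, of "G 0"] by (simp add: at_within_open[OF that])
  show thesis
  proof (rule that)
    show "(\<lambda>z. G z - G 0) holomorphic_on ball 0 1"
      unfolding holomorphic_on_open[OF open_ball] using D by blast
    show "deriv (\<lambda>z. G z - G 0) z = k z" if "z \<in> ball 0 1" for z
      using DERIV_imp_deriv[OF D[OF that]] .
  qed simp
qed

text \<open>The derivative of the extremal function is \<open>(1 - z)\<^sup>-\<^sup>\<alpha>\<close>, for which
  \<open>1 + z h''/h' = 1 - \<alpha> + \<alpha> / (1 - z)\<close>; the disc is mapped by \<open>1 / (1 - z)\<close> to the half-plane
  of real part greater than \<open>1/2\<close>.\<close>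

lemma class_F_extremal:
  fixes \<alpha> :: real
  assumes \<alpha>: "\<alpha> > 0"
  obtains h where "h \<in> class_F \<alpha>"
    "\<And>z::complex. z \<in> ball 0 1 \<Longrightarrow> deriv (deriv h) z / deriv h z = \<alpha> / (1 - z)"
proof -
  define k where "k = (\<lambda>z. exp (- of_real \<alpha> * Ln (1 - z)))"
  have right: "Re (1 - z) > 0" if "z \<in> ball 0 1" for z
    using that complex_Re_le_cmod[of z] by simp
  have Dk: "(k has_field_derivative \<alpha> / (1 - z) * k z) (at z)" if "z \<in> ball 0 1" for z :: complex
  proof -
    have "1 - z \<notin> \<real>\<^sub>\<le>\<^sub>0" "1 - z \<noteq> 0"
      using right[OF that] by (auto simp: complex_nonpos_Reals_iff)
    then show ?thesis
      unfolding k_def by (auto intro!: derivative_eq_intros simp: divide_inverse mult_ac)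
  qed
  then have "k holomorphic_on ball 0 1"
    unfolding holomorphic_on_open[OF open_ball] by blast
  then obtain h where h: "h holomorphic_on ball 0 1" "h 0 = 0"
      and dh: "\<And>z. z \<in> ball 0 1 \<Longrightarrow> deriv h z = k z"
    using normalised_primitive_on_disc by blast
  have ratio: "deriv (deriv h) z / deriv h z = \<alpha> / (1 - z)" if z: "z \<in> ball 0 1" for z :: complex
  proof -
    have "(deriv h has_field_derivative \<alpha> / (1 - z) * k z) (at z)"
      by (rule has_field_derivative_transform_within_open[OF Dk[OF z] open_ball z])
         (simp add: dh)
    then have "deriv (deriv h) z = \<alpha> / (1 - z) * k z"
      by (rule DERIV_imp_deriv)
    then show ?thesis
      by (simp add: dh[OF z] k_def)
  qed
  have "Re (1 + z * deriv (deriv h) z / deriv h z) > 1 - \<alpha> / 2" if z: "z \<in> ball 0 1" for z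
  proof -
    have "1 - z \<noteq> 0"
      using right[OF z] by auto
    then have "1 + z * deriv (deriv h) z / deriv h z = of_real (1 - \<alpha>) + of_real \<alpha> * (1 / (1 - z))"
      unfolding times_divide_eq_right[symmetric] ratio[OF z] by (simp add: field_simps)
    moreover have "Re (of_real (1 - \<alpha>) + of_real \<alpha> * w) = 1 - \<alpha> + \<alpha> * Re w" for w
      by simp
    moreover have "Re (1 / (1 - z)) > 1 / 2"
    proof -
      have "(cmod z)\<^sup>2 < 1"
        using z by (simp add: power_less_one_iff abs_square_less_1)
      then have "(Re z)\<^sup>2 + (Im z)\<^sup>2 < 1"
        by (simp add: cmod_power2)
      then have "(1 - Re z)\<^sup>2 + (Im z)\<^sup>2 < 2 * (1 - Re z)"
        by (simp add: power2_eq_square algebra_simps)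
      moreover have "(1 - Re z)\<^sup>2 + (Im z)\<^sup>2 > 0"
        using right[OF z] by (simp add: add_pos_nonneg)
      ultimately show ?thesis
        by (simp add: Re_divide field_simps)
    qed
    then have "\<alpha> * (1 / 2) < \<alpha> * Re (1 / (1 - z))"
      using \<alpha> by (rule mult_strict_left_mono)
    ultimately show ?thesis
      by (simp only:)
  qed
  then have "h \<in> class_F \<alpha>"
    using h dh by (auto simp: class_F_def class_A_def k_def)
  with ratio that show thesis
    by blast
qed

lemma class_FH_with_dilatation:
  assumes h: "h \<in> class_F \<alpha>" and hol: "\<omega> holomorphic_on ball 0 1"
    and less1: "\<And>z. z \<in> ball 0 1 \<Longrightarrow> cmod (\<omega> z) < 1"
  obtains f where "f \<in> class_FH \<alpha>"
    "\<And>z. z \<in> ball 0 1 \<Longrightarrow> pre_schwarzian f z =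
      deriv (deriv h) z / deriv h z - cnj (\<omega> z) * deriv \<omega> z / (1 - (cmod (\<omega> z))\<^sup>2)"
proof -
  have hA: "h \<in> class_A" and h': "\<And>z. z \<in> ball 0 1 \<Longrightarrow> deriv h z \<noteq> 0"
    using h by (auto simp: class_F_def)
  have "(\<lambda>z. \<omega> z * deriv h z) holomorphic_on ball 0 1"
    using hA by (intro holomorphic_intros hol) (auto simp: class_A_def)
  then obtain g where g: "g holomorphic_on ball 0 1" "g 0 = 0"
      and dg: "\<And>z. z \<in> ball 0 1 \<Longrightarrow> deriv g z = \<omega> z * deriv h z"
    using normalised_primitive_on_disc by blast
  define f where "f = (\<lambda>z. h z + cnj (g z))"
  have rep: "harmonic_rep f h g"
    using hA g by (simp add: harmonic_rep_def f_def)
  have dil: "dilatation \<omega> h g"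
    using hol less1 dg by (simp add: dilatation_def)
  have "jacobian f z > 0" if z: "z \<in> ball 0 1" for z
  proof -
    have "cmod (deriv g z) < cmod (deriv h z)"
      using less1[OF z] h'[OF z] by (simp add: dg[OF z] norm_mult)
    then show ?thesis
      unfolding jacobian_harmonic[OF rep z] by (simp add: power_strict_mono)
  qed
  then have "f \<in> class_FH \<alpha>"
    using rep dil h by (auto simp: class_FH_def sense_preserving_def)
  with pre_schwarzian_harmonic[OF rep dil h'] that show thesis
    by blast
qed

text \<open>Disc automorphisms give equality in the Schwarz--Pick inequality, and their orientation can be
  chosen so that \<open>\<omega>\<close> and \<open>- \<omega>'\<close> are both positive at \<open>x\<close>. The parameter
  \<open>a = (t + x) / (1 + t x)\<close> solves \<open>(a - x) / (1 - a x) = t\<close>.\<close>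

lemma extremal_dilatation:
  fixes x t :: real
  assumes x: "0 < x" "x < 1" and t: "0 < t" "t < 1"
  obtains \<omega> where "\<omega> holomorphic_on ball 0 1" "\<And>z. z \<in> ball 0 1 \<Longrightarrow> cmod (\<omega> z) < 1"
    "\<omega> (of_real x) = of_real t" "deriv \<omega> (of_real x) = - of_real ((1 - t\<^sup>2) / (1 - x\<^sup>2))"
proof -
  define a where "a = (t + x) / (1 + t * x)"
  have tx: "1 + t * x > 0"
    using x t by (simp add: add_pos_pos)
  have "(1 - t) * (1 - x) > 0"
    using x t by simp
  then have a: "0 < a" "a < 1"
    using x t tx by (auto simp: a_def field_simps intro: add_pos_pos)
  have 1: "1 - a * x = (1 - x\<^sup>2) / (1 + t * x)" and 2: "a - x = t * (1 - x\<^sup>2) / (1 + t * x)"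
    using tx by (simp_all add: a_def field_simps power2_eq_square)
  have "1 - a\<^sup>2 = ((1 + t * x)\<^sup>2 - (t + x)\<^sup>2) / (1 + t * x)\<^sup>2"
    using tx by (simp add: a_def power_divide diff_divide_distrib)
  also have "(1 + t * x)\<^sup>2 - (t + x)\<^sup>2 = (1 - t\<^sup>2) * (1 - x\<^sup>2)"
    by (simp add: power2_eq_square algebra_simps)
  finally have 3: "1 - a\<^sup>2 = (1 - t\<^sup>2) * (1 - x\<^sup>2) / (1 + t * x)\<^sup>2" .
  have x2: "1 - x\<^sup>2 > 0"
    using x by (simp add: power_less_one_iff abs_square_less_1)
  have ne: "1 - cnj (of_real a) * complex_of_real x \<noteq> 0"
    by (rule one_minus_cnj_mult_ne_zero) (use a x in auto)
  define \<omega> where "\<omega> = (\<lambda>z. - Moebius_function 0 (of_real a) z)"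
  show thesis
  proof (rule that)
    show "\<omega> holomorphic_on ball 0 1"
      unfolding \<omega>_def using a by (intro holomorphic_intros Moebius_function_holomorphic) auto
    show "cmod (\<omega> z) < 1" if "z \<in> ball 0 1" for z
      unfolding \<omega>_def using a that Moebius_function_norm_lt_1[of "of_real a" z] by simp
    have "(a - x) / (1 - a * x) = t"
      unfolding 1 2 using tx x2 by simp
    moreover have "\<omega> (of_real x) = of_real ((a - x) / (1 - a * x))"
      by (simp add: \<omega>_def Moebius_function_simple minus_divide_left)
    ultimately show "\<omega> (of_real x) = of_real t"
      by simp
    have "(\<omega> has_field_derivative
        - ((1 - of_real ((cmod (of_real a))\<^sup>2)) / (1 - cnj (of_real a) * of_real x)\<^sup>2))
        (at (of_real x))"
      unfolding \<omega>_def by (rule DERIV_minus[OF Moebius_function_has_field_derivative[OF ne]])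
    then have "deriv \<omega> (of_real x) = - of_real ((1 - a\<^sup>2) / (1 - a * x)\<^sup>2)"
      by (simp add: DERIV_imp_deriv)
    also have "(1 - a\<^sup>2) / (1 - a * x)\<^sup>2 = (1 - t\<^sup>2) / (1 - x\<^sup>2)"
      unfolding 1 3 using tx x2 by (simp add: power_divide power2_eq_square)
    finally show "deriv \<omega> (of_real x) = - of_real ((1 - t\<^sup>2) / (1 - x\<^sup>2))" .
  qed
qed

lemma class_FH_near_extremal:
  fixes \<alpha> x t :: real
  assumes \<alpha>: "\<alpha> > 0" and x: "0 < x" "x < 1" and t: "0 < t" "t < 1"
  obtains f where "f \<in> class_FH \<alpha>" "ereal (\<alpha> * (1 + x) + t) \<le> pre_schwarzian_norm f"
proof -
  have xb: "complex_of_real x \<in> ball 0 1"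
    using x by simp
  obtain h where h: "h \<in> class_F \<alpha>"
    "\<And>z::complex. z \<in> ball 0 1 \<Longrightarrow> deriv (deriv h) z / deriv h z = \<alpha> / (1 - z)"
    using class_F_extremal[OF \<alpha>] by blast
  obtain \<omega> where \<omega>: "\<omega> holomorphic_on ball 0 1" "\<And>z. z \<in> ball 0 1 \<Longrightarrow> cmod (\<omega> z) < 1"
    and \<omega>x: "\<omega> (of_real x) = of_real t" "deriv \<omega> (of_real x) = - of_real ((1 - t\<^sup>2) / (1 - x\<^sup>2))"
    using extremal_dilatation[OF x t] by blast
  obtain f where f: "f \<in> class_FH \<alpha>"
    and P: "\<And>z. z \<in> ball 0 1 \<Longrightarrow> pre_schwarzian f z =
      deriv (deriv h) z / deriv h z - cnj (\<omega> z) * deriv \<omega> z / (1 - (cmod (\<omega> z))\<^sup>2)"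
    using class_FH_with_dilatation[OF h(1) \<omega>] by blast
  have x2: "1 - x\<^sup>2 > 0" and t2: "1 - t\<^sup>2 > 0"
    using x t by (simp_all add: power_less_one_iff abs_square_less_1)
  have "pre_schwarzian f (of_real x) =
      of_real (\<alpha> / (1 - x) + t * ((1 - t\<^sup>2) / (1 - x\<^sup>2)) / (1 - t\<^sup>2))"
    unfolding P[OF xb] h(2)[OF xb] \<omega>x norm_of_real power2_abs
    by (simp only: complex_cnj_complex_of_real of_real_add of_real_divide of_real_mult of_real_diff
        of_real_1 mult_minus_right minus_divide_left[symmetric] diff_minus_eq_add)
  also have "\<alpha> / (1 - x) + t * ((1 - t\<^sup>2) / (1 - x\<^sup>2)) / (1 - t\<^sup>2) = (\<alpha> * (1 + x) + t) / (1 - x\<^sup>2)"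
  proof -
    have "\<alpha> / (1 - x) = \<alpha> * (1 + x) / (1 - x\<^sup>2)"
      using x x2 by (simp add: divide_simps) (simp add: power2_eq_square algebra_simps)
    then show ?thesis
      using t2 by (simp add: add_divide_distrib)
  qed
  finally have "cmod (pre_schwarzian f (of_real x)) = (\<alpha> * (1 + x) + t) / (1 - x\<^sup>2)"
    using \<alpha> x t x2 by (simp only: norm_of_real) simp
  then have "\<alpha> * (1 + x) + t = (1 - (cmod (of_real x))\<^sup>2) * cmod (pre_schwarzian f (of_real x))"
    using x2 by simp
  then have "ereal (\<alpha> * (1 + x) + t) \<le> pre_schwarzian_norm f"
    unfolding pre_schwarzian_norm_def by (intro SUP_upper2[OF xb]) simp
  with f that show thesis
    by blast
qed

theorem theorem6p1:
  fixes \<alpha> :: real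
  assumes "\<alpha> \<in> {0<..3}"
  shows "(\<forall>f\<in>class_FH \<alpha>. pre_schwarzian_norm f \<le> ereal (2 * \<alpha> + 1)) \<and>
    \<not> (\<exists>c::real. c < 2 * \<alpha> + 1 \<and> (\<forall>f\<in>class_FH \<alpha>. pre_schwarzian_norm f \<le> ereal c))"
proof (intro conjI notI)
  have \<alpha>: "\<alpha> > 0"
    using assms by simp
  show "\<forall>f\<in>class_FH \<alpha>. pre_schwarzian_norm f \<le> ereal (2 * \<alpha> + 1)"
    using pre_schwarzian_norm_le[OF \<alpha>] by blast
  assume "\<exists>c. c < 2 * \<alpha> + 1 \<and> (\<forall>f\<in>class_FH \<alpha>. pre_schwarzian_norm f \<le> ereal c)"
  then obtain c where c: "c < 2 * \<alpha> + 1" "\<And>f. f \<in> class_FH \<alpha> \<Longrightarrow> pre_schwarzian_norm f \<le> ereal c"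
    by blast
  \<comment> \<open>Taking the same \<open>x\<close> for the point and for the value of the dilatation there, the
    condition \<open>\<alpha> (1 + x) + x > c\<close> is solved for \<open>x\<close>.\<close>
  have "max 0 ((c - \<alpha>) / (\<alpha> + 1)) < 1"
    using c(1) \<alpha> by simp
  then obtain x where x: "max 0 ((c - \<alpha>) / (\<alpha> + 1)) < x" "x < 1"
    using dense by blast
  then have x0: "0 < x" and xc: "c < \<alpha> * (1 + x) + x"
    using \<alpha> by (auto simp: field_simps)
  obtain f where "f \<in> class_FH \<alpha>" "ereal (\<alpha> * (1 + x) + x) \<le> pre_schwarzian_norm f"
    using class_FH_near_extremal[OF \<alpha> x0 x(2) x0 x(2)] by blast
  then have "ereal (\<alpha> * (1 + x) + x) \<le> ereal c"
    using c(2) order_trans by blast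
  with xc show False
    by simp
qed

end
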